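(* Let $p\in\mathcal{P}^{\log}(\mathbb{R}^n)$ and $m>n$ with $2\le p^-$ and $p_\infty=\infty$. Then there is a constant $C>0$ such that for every $t>0$ and every $f\in L^{p(\cdot)/2}(\mathbb{R}^n)$, $$\|\eta_{t,m}*f\|_{L^{p(\cdot)}(\mathbb{R}^n)}\le C\,t^{-n\vartheta(t)}\,\|f\|_{L^{p(\cdot)/2}(\mathbb{R}^n)},$$ where $\vartheta(t)=\frac{2}{p^-}$ if $0<t\le1$ and $\vartheta(t)=0$ if $t>1$.
   Context: $\mathcal{P}(\mathbb{R}^n)$ is the set of measurable functions $p:\mathbb{R}^n\to[1,\infty]$; $p^-$ and $p^+$ are the essential infimum and supremum of $p$; $\frac1\infty:=0$. The modular is $\varrho_{p(\cdot)}(f)=\int_{\mathbb{R}^n}\omega_{p(x)}(|f(x)|)\,dx$, with $\omega_p(t)=t^p$ if $p<\infty$, and $\omega_\infty(t)=0$ for $t\le1$, $\omega_\infty(t)=\infty$ for $t>1$. $L^{p(\cdot)}(\mathbb{R}^n)$ is the space of measurable $f$ with $\varrho_{p(\cdot)}(\lambda f)<\infty$ for some $\lambda>0$, normed by $\|f\|_{L^{p(\cdot)}}=\inf\{\lambda>0:\varrho_{p(\cdot)}(f/\lambda)\le1\}$. A real function $g$ on $\mathbb{R}^n$ is globally log-Hölder continuous if there are $c>0$ and $g_\infty\in\mathbb{R}$ with $|g(x)-g(y)|\le \frac{c}{\log(e+1/|x-y|)}$ and $|g(x)-g_\infty|\le\frac{c}{\log(e+|x|)}$ for all $x,y$. $\mathcal{P}^{\log}(\mathbb{R}^n)$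 is the set of $p\in\mathcal{P}(\mathbb{R}^n)$ with $1/p$ globally log-Hölder continuous, and $p_\infty\in[1,\infty]$ is defined by $\frac1{p_\infty}=\lim_{|x|\to\infty}\frac1{p(x)}$. $\eta_{t,m}(x):=t^{-n}(1+t^{-1}|x|)^{-m}$ for $x\in\mathbb{R}^n$, $t>0$, $m>0$. *)

theory Defs
  imports "HOL-Analysis.Analysis"
begin

text \<open>
  Exponents take values in \<^typ>\<open>ennreal\<close>, where \<open>1 / \<infinity> = 0\<close> and \<open>\<infinity> / 2 = \<infinity>\<close>.
  Measurability is Lebesgue measurability throughout, and elements of the function
  spaces are represented by functions rather than by classes modulo null sets.
\<close>

definition exponents :: "(real^'n \<Rightarrow> ennreal) set" where
  "exponents = {p. p \<in> borel_measurable lebesgue \<and> (\<forall>x. 1 \<le> p x)}"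

definition exponent_minus :: "(real^'n \<Rightarrow> ennreal) \<Rightarrow> ennreal" where
  "exponent_minus p = Sup {a. AE x in lebesgue. a \<le> p x}"

text \<open>For \<open>x = y\<close> the local condition reads \<open>0 \<le> c\<close>, because \<open>1 / 0 = 0\<close> in \<^typ>\<open>real\<close>.\<close>

definition globally_log_Hoelder :: "(real^'n \<Rightarrow> real) \<Rightarrow> bool" where
  "globally_log_Hoelder g \<longleftrightarrow>
     (\<exists>c>0. \<exists>g_inf.
        (\<forall>x y. \<bar>g x - g y\<bar> \<le> c / ln (exp 1 + 1 / norm (x - y))) \<and>
        (\<forall>x. \<bar>g x - g_inf\<bar> \<le> c / ln (exp 1 + norm x)))"

definition log_exponents :: "(real^'n \<Rightarrow> ennreal) set" where
  "log_exponents = {p \<in> exponents. globally_log_Hoelder (\<lambda>x. enn2real (1 / p x))}"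

text \<open>The limit exists for every member of \<open>log_exponents\<close>; \<open>1 / 0 = \<infinity>\<close> in \<^typ>\<open>ennreal\<close>.\<close>

definition exponent_infinity :: "(real^'n \<Rightarrow> ennreal) \<Rightarrow> ennreal" where
  "exponent_infinity p = 1 / Lim at_infinity (\<lambda>x. 1 / p x)"

text \<open>Used only for \<open>t \<ge> 0\<close>; note that \<open>0 powr a = 0\<close>.\<close>

definition omega :: "ennreal \<Rightarrow> real \<Rightarrow> ennreal" where
  "omega p t = (if p = \<infinity> then (if t \<le> 1 then 0 else \<infinity>) else ennreal (t powr enn2real p))"

definition modular :: "(real^'n \<Rightarrow> ennreal) \<Rightarrow> (real^'n \<Rightarrow> complex) \<Rightarrow> ennreal" where
  "modular p f = (\<integral>\<^sup>+ x. omega (p x) (norm (f x)) \<partial>lebesgue)"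

definition Lp_var :: "(real^'n \<Rightarrow> ennreal) \<Rightarrow> (real^'n \<Rightarrow> complex) set" where
  "Lp_var p = {f \<in> borel_measurable lebesgue. \<exists>a::real. a > 0 \<and> modular p (\<lambda>x. a *\<^sub>R f x) < \<infinity>}"

text \<open>The infimum is taken in \<^typ>\<open>ennreal\<close>, so that it is \<open>\<infinity>\<close> over the empty set.\<close>

definition Lp_var_norm :: "(real^'n \<Rightarrow> ennreal) \<Rightarrow> (real^'n \<Rightarrow> complex) \<Rightarrow> ennreal" where
  "Lp_var_norm p f = Inf {ennreal a |a. a > 0 \<and> modular p (\<lambda>x. f x /\<^sub>R a) \<le> 1}"

definition eta :: "real \<Rightarrow> real \<Rightarrow> real^'n \<Rightarrow> real" where
  "eta t m x = t powr (- real CARD('n)) * (1 + norm x / t) powr (- m)"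

text \<open>
  The Bochner integral is \<open>0\<close> where the integrand is not integrable, hence the separate
  predicate stating that the convolution is defined almost everywhere.
\<close>

definition convolution :: "(real^'n \<Rightarrow> real) \<Rightarrow> (real^'n \<Rightarrow> complex) \<Rightarrow> real^'n \<Rightarrow> complex" where
  "convolution g f x = (\<integral>y. g (x - y) *\<^sub>R f y \<partial>lebesgue)"

definition convolution_exists :: "(real^'n \<Rightarrow> real) \<Rightarrow> (real^'n \<Rightarrow> complex) \<Rightarrow> bool" where
  "convolution_exists g f \<longleftrightarrow> (AE x in lebesgue. integrable lebesgue (\<lambda>y. g (x - y) *\<^sub>R f y))"

definition vartheta :: "(real^'n \<Rightarrow> ennreal) \<Rightarrow> real \<Rightarrow> real" where
  "vartheta p t = (if t \<le> 1 then enn2real (2 / exponent_minus p) else 0)"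

end

theory Submission
  imports Defs
begin

text \<open>
  Since \<open>p\<^sub>\<infinity> = \<infinity>\<close>, the decay condition gives \<open>p(x) \<ge> ln (e + |x|) / c\<close>, so constants have finite
  \<open>L\<^sup>p\<close> norm and it suffices to bound \<open>\<eta> * f\<close> uniformly. Let the modular of \<open>f\<close> for the exponent
  \<open>p/2\<close> be at most \<open>1\<close> and put \<open>K = t powr (- n \<vartheta>(t)) \<ge> 1\<close>. Pointwise,
  \<open>|f| \<le> K + K t\<^sup>n |f| powr (p/2)\<close>; integrating against \<open>\<eta>\<close>, which has bounded integral and
  is at most \<open>t powr (- n)\<close>, bounds \<open>\<eta> * f\<close> by a multiple of \<open>K\<close>.
\<close>

text \<open>The degenerate values agree by convention: \<open>enn2real\<close> sends
  \<open>\<infinity>\<close> to 0, and \<open>inverse 0 = 0\<close> in the reals.\<close>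

lemma enn2real_inverse: "enn2real (inverse a) = inverse (enn2real a)"
proof (cases a)
  case (real r)
  then show ?thesis by (cases "r = 0") (auto simp: inverse_ennreal)
qed simp

lemma enn2real_divide: "enn2real (a / b) = enn2real a / enn2real b"
  by (simp add: divide_ennreal_def divide_real_def enn2real_mult enn2real_inverse)

section \<open>Essential infimum and decay of the exponent\<close>

text \<open>The supremum ranges over uncountably many lower bounds, but a sequence of them already
  attains it, so that only countably many null sets have to be united.\<close>

lemma AE_exponent_minus_le: "AE x in lebesgue. exponent_minus p \<le> p x"
proof -
  let ?S = "{a. AE x in lebesgue. a \<le> p x}"
  have "?S \<noteq> {}" by (auto intro!: exI[of _ 0])
  then obtain s :: "nat \<Rightarrow> ennreal" where s: "range s \<subseteq> ?S" "Sup ?S = (SUP i. s i)"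
    using ennreal_Sup_countable_SUP[of ?S] by metis
  have "AE x in lebesgue. \<forall>i. s i \<le> p x"
    unfolding AE_all_countable using s(1) by auto
  then show ?thesis
    unfolding exponent_minus_def s(2) by eventually_elim (auto intro: SUP_least)
qed

text \<open>The decay condition makes \<open>1 / p\<close> converge to \<open>g_inf\<close>, and
  \<open>exponent_infinity p = \<infinity>\<close> forces this limit to be 0. Hence
  \<open>1 / p\<close> is at most \<open>c / ln (exp 1 + norm x)\<close>, which is then inverted.
  Points with \<open>p x = \<infinity>\<close> are excluded because \<open>enn2real\<close> is 0
  there.\<close>

lemma log_exponent_ge_ln:
  fixes p :: "real^'n \<Rightarrow> ennreal"
  assumes p: "p \<in> log_exponents" and inf: "exponent_infinity p = \<infinity>"
  obtains c where "c > 0" "\<And>x. p x \<noteq> \<infinity> \<Longrightarrow> ln (exp 1 + norm x) / c \<le> enn2real (p x)"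
proof -
  define g where "g = (\<lambda>x. enn2real (1 / p x))"
  have p1: "1 \<le> p x" for x using p by (auto simp: log_exponents_def exponents_def)
  obtain c g_inf where c: "c > 0" and g: "\<And>x. \<bar>g x - g_inf\<bar> \<le> c / ln (exp 1 + norm x)"
    using p unfolding log_exponents_def globally_log_Hoelder_def g_def by blast
  \<comment> \<open>The bound excludes the value \<open>\<infinity>\<close>, so that passing from
    \<open>1 / p x\<close> to the real number \<open>g x\<close> loses nothing.\<close>
  have le1: "1 / p x \<le> 1" for x
    using p1[of x] by (simp add: divide_le_posI_ennreal order.strict_trans2[OF zero_less_one])
  have g_eq: "1 / p x = ennreal (g x)" for x
    unfolding g_def using le1[of x] by (subst ennreal_enn2real) (auto simp: less_top[symmetric] top_unique)
  have "((\<lambda>x::real^'n. c / ln (exp 1 + norm x)) \<longlongrightarrow> 0) at_infinity"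
  proof (rule real_tendsto_divide_at_top[OF tendsto_const])
    show "filterlim (\<lambda>x::real^'n. ln (exp 1 + norm x)) at_top at_infinity"
      by (intro filterlim_compose[OF ln_at_top] filterlim_tendsto_add_at_top[OF tendsto_const]
          filterlim_norm_at_top)
  qed
  then have "((\<lambda>x. g x - g_inf) \<longlongrightarrow> 0) at_infinity"
    by (rule Lim_null_comparison[rotated]) (use g in auto)
  then have "(g \<longlongrightarrow> g_inf) at_infinity" by (simp add: LIM_zero_iff)
  then have "((\<lambda>x. 1 / p x) \<longlongrightarrow> ennreal g_inf) at_infinity"
    unfolding g_eq by (intro tendsto_ennrealI)
  then have "Lim at_infinity (\<lambda>x. 1 / p x) = ennreal g_inf"
    by (intro tendsto_Lim) (auto simp: trivial_limit_at_infinity)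
  \<comment> \<open>Only an inequality results, since \<open>ennreal\<close> truncates negative
    reals to 0; it is the direction needed to bound \<open>g\<close> from above.\<close>
  with inf have "g_inf \<le> 0"
    unfolding exponent_infinity_def by (auto simp: divide_ennreal_def ennreal_eq_0_iff top_unique
        ennreal_mult_eq_top_iff ennreal_inverse_eq_top_iff)
  have "ln (exp 1 + norm x) / c \<le> enn2real (p x)" if fin: "p x \<noteq> \<infinity>" for x
  proof -
    have "exp 1 + norm x > 1" by (smt (verit) norm_ge_zero exp_ge_add_one_self)
    then have ln_pos: "ln (exp 1 + norm x) > 0" by (rule ln_gt_zero)
    have "1 \<le> enn2real (p x)" using p1[of x] fin enn2real_mono[of 1 "p x"] by (simp add: less_top)
    moreover have "g x = 1 / enn2real (p x)" unfolding g_def by (simp add: enn2real_divide)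
    moreover have "g x \<le> c / ln (exp 1 + norm x)" using g[of x] \<open>g_inf \<le> 0\<close> by linarith
    ultimately have "ln (exp 1 + norm x) / enn2real (p x) \<le> c" "enn2real (p x) > 0"
      using ln_pos by (simp_all add: pos_le_divide_eq)
    then show ?thesis using c by (simp add: divide_simps mult.commute)
  qed
  with c show ?thesis by (rule that)
qed

section \<open>The kernel\<close>

lemma eta_nonneg: "0 \<le> eta t m x"
  by (simp add: eta_def)

lemma eta_le:
  assumes "t > 0" "m \<ge> 0"
  shows "eta t m (x::real^'n) \<le> t powr (- real CARD('n))"
proof -
  have "(1 + norm x / t) powr (- m) \<le> 1"
    using assms powr_mono[of "-m" 0 "1 + norm x / t"] by (simp add: powr_zero_eq_one add_nonneg_eq_0_iff)
  then show ?thesis unfolding eta_def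
    using mult_left_mono[of _ 1 "t powr (- real CARD('n))"] by simp
qed

lemma borel_measurable_eta [measurable]: "eta t m \<in> borel_measurable borel"
  unfolding eta_def[abs_def] by measurable

text \<open>For the \<open>k\<close> with \<open>2 ^ k \<le> 1 + u < 2 ^ Suc k\<close>, the
  \<open>k\<close>-th term alone dominates the left-hand side. Composed with a norm, the indicators
  become indicators of balls, so a radial integral reduces to a series of ball volumes.\<close>

lemma powr_le_suminf_dyadic:
  assumes "(m::real) > 0" "u \<ge> 0"
  shows "ennreal ((1 + u) powr (- m))
    \<le> (\<Sum>k. ennreal ((2 powr (- m)) ^ k) * indicator {..<2 ^ Suc k} u)"
proof -
  define k where "k = nat \<lfloor>log 2 (1 + u)\<rfloor>"
  have l0: "0 \<le> log 2 (1 + u)" using assms by simp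
  then have k: "real k \<le> log 2 (1 + u)" "log 2 (1 + u) < real (Suc k)"
    unfolding k_def by linarith+
  have "2 powr real k \<le> 1 + u" "1 + u < 2 powr real (Suc k)"
    using k assms by (simp_all add: le_log_iff log_less_iff del: of_nat_Suc)
  then have lo: "2 ^ k \<le> 1 + u" and hi: "u < 2 ^ Suc k"
    by (simp_all only: powr_realpow zero_less_numeral)
  have "(1 + u) powr (- m) \<le> (2 ^ k) powr (- m)"
    using lo assms by (intro powr_mono2') auto
  also have "\<dots> = (2 powr (- m)) ^ k"
    by (simp add: powr_realpow[symmetric] powr_powr mult.commute)
  finally have "ennreal ((1 + u) powr (- m)) \<le> ennreal ((2 powr (- m)) ^ k) * indicator {..<2 ^ Suc k} u"
    using hi by (simp add: ennreal_leI)
  also have "\<dots> \<le> (\<Sum>k. ennreal ((2 powr (- m)) ^ k) * indicator {..<2 ^ Suc k} u)" (is "?f k \<le> _")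
  proof -
    have "sum ?f {k} \<le> suminf ?f" by (rule sum_le_suminf) auto
    then show ?thesis by (simp only: sum.insert sum.empty finite.emptyI empty_iff add_0_right not_False_eq_True)
  qed
  finally show ?thesis .
qed

text \<open>In the dyadic majorant the ball of radius \<open>t * 2 ^ Suc k\<close> has volume
  proportional to the \<open>n\<close>-th power of its radius. The powers of \<open>t\<close>
  cancel, which makes the bound uniform in \<open>t\<close> and \<open>x\<close>, and a geometric
  series of ratio \<open>2 powr (n - m) < 1\<close> remains.\<close>

lemma nn_integral_eta_bound:
  assumes m: "m > real CARD('n)"
  obtains A where "A > 0"
    "\<And>t (x::real^'n). t > 0 \<Longrightarrow> (\<integral>\<^sup>+ y. ennreal (eta t m (x - y)) \<partial>lebesgue) \<le> ennreal A"
proof -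
  let ?n = "real CARD('n)"
  define V where "V = unit_ball_vol ?n"
  define q where "q = 2 powr (?n - m)"
  have q: "0 < q" "q < 1" unfolding q_def using m by (auto simp: powr_less_one)
  have V: "V \<ge> 0" unfolding V_def by simp
  \<comment> \<open>The first summand is the value of the geometric series; the added 1 gives
    \<open>A > 0\<close> from \<open>V \<ge> 0\<close> alone.\<close>
  define A where "A = V * 2 powr ?n / (1 - q) + 1"
  have "A > 0" unfolding A_def using q V by (intro add_nonneg_pos divide_nonneg_pos) auto
  moreover have "(\<integral>\<^sup>+ y. ennreal (eta t m (x - y)) \<partial>lebesgue) \<le> ennreal A" if t: "t > 0"
    for t and x :: "real^'n"
  proof -
    let ?b = "\<lambda>k. ball x (t * 2 ^ Suc k)"
    define F where "F = (\<lambda>k y. ennreal ((2 powr (- m)) ^ k) * indicator (?b k) y)"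
    have b_sets: "?b k \<in> sets lebesgue" for k by (rule fmeasurableD[OF lmeasurable_ball])
    have F_meas: "F k \<in> borel_measurable lebesgue" for k
      unfolding F_def by (rule borel_measurable_times_ennreal[OF borel_measurable_const borel_measurable_indicator[OF b_sets]])
    have F_eq: "ennreal ((2 powr (- m)) ^ k) * indicator {..<2 ^ Suc k} (norm (x - y) / t) = F k y" for k y
    proof -
      have "norm (x - y) / t < 2 ^ Suc k \<longleftrightarrow> dist x y < t * 2 ^ Suc k"
        by (simp only: pos_divide_less_eq[OF t] dist_norm mult.commute)
      then show ?thesis by (simp only: F_def indicator_def lessThan_iff mem_ball)
    qed
    have "(\<integral>\<^sup>+ y. ennreal (eta t m (x - y)) \<partial>lebesgue)
        \<le> (\<integral>\<^sup>+ y. ennreal (t powr (- ?n)) * (\<Sum>k. F k y) \<partial>lebesgue)"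
    proof (rule nn_integral_mono)
      fix y
      have "ennreal (eta t m (x - y)) = ennreal (t powr (- ?n)) * ennreal ((1 + norm (x - y) / t) powr (- m))"
        unfolding eta_def by (simp add: ennreal_mult)
      also have "ennreal ((1 + norm (x - y) / t) powr (- m)) \<le> (\<Sum>k. F k y)"
        unfolding F_eq[symmetric] using m t by (intro powr_le_suminf_dyadic) auto
      finally show "ennreal (eta t m (x - y)) \<le> ennreal (t powr (- ?n)) * (\<Sum>k. F k y)"
        by (simp add: mult_left_mono)
    qed
    also have "\<dots> = ennreal (t powr (- ?n)) * (\<integral>\<^sup>+ y. (\<Sum>k. F k y) \<partial>lebesgue)"
      using F_meas by (intro nn_integral_cmult borel_measurable_suminf_order)
    also have "(\<integral>\<^sup>+ y. (\<Sum>k. F k y) \<partial>lebesgue) = (\<Sum>k. \<integral>\<^sup>+ y. F k y \<partial>lebesgue)"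
      using F_meas by (rule nn_integral_suminf)
    also have "\<dots> = (\<Sum>k. ennreal ((2 powr (- m)) ^ k) * emeasure lebesgue (?b k))"
      unfolding F_def by (intro suminf_cong nn_integral_cmult_indicator b_sets)
    also have "ennreal (t powr (- ?n)) * (\<Sum>k. ennreal ((2 powr (- m)) ^ k) * emeasure lebesgue (?b k))
        = (\<Sum>k. ennreal (V * 2 powr ?n * q ^ k))"
    proof (subst ennreal_suminf_cmult[symmetric], rule suminf_cong)
      fix k
      have pos: "0 < t * 2 ^ Suc k" using t by simp
      have ball_eq: "emeasure lebesgue (?b k) = ennreal (V * (t * 2 ^ Suc k) powr ?n)"
        using pos by (simp add: emeasure_ball V_def powr_realpow del: power_Suc)
      have real_eq: "t powr (- ?n) * ((2 powr (- m)) ^ k * (V * (t * 2 ^ Suc k) powr ?n)) = V * 2 powr ?n * q ^ k"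
      proof -
        have dilate: "(t * 2 ^ Suc k) powr ?n = t powr ?n * 2 powr ?n * (2 powr ?n) ^ k"
        proof -
          have "(2 ^ Suc k) powr ?n = (2 powr ?n) ^ Suc k"
            unfolding powr_realpow[OF zero_less_numeral] powr_realpow[OF zero_less_power[OF zero_less_numeral]]
            by (simp only: power_mult[symmetric] mult.commute)
          then show ?thesis using t by (simp only: powr_mult power_Suc mult.assoc)
        qed
        have q_pow: "q ^ k = (2 powr ?n) ^ k * (2 powr (- m)) ^ k"
          unfolding q_def power_mult_distrib[symmetric] powr_add[symmetric] by simp
        have inv: "t powr (- ?n) * t powr ?n = 1"
          using t by (simp only: powr_add[symmetric]) simp
        have "t powr (- ?n) * ((2 powr (- m)) ^ k * (V * (t * 2 ^ Suc k) powr ?n))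
            = (t powr (- ?n) * t powr ?n) * (V * 2 powr ?n * q ^ k)"
          unfolding dilate q_pow by (simp only: mult_ac)
        then show ?thesis using inv by (simp only: mult_1_left)
      qed
      show "ennreal (t powr (- ?n)) * (ennreal ((2 powr (- m)) ^ k) * emeasure lebesgue (?b k))
          = ennreal (V * 2 powr ?n * q ^ k)"
        unfolding ball_eq real_eq[symmetric] using V by (simp add: ennreal_mult del: power_Suc)
    qed
    also have "\<dots> = ennreal (V * 2 powr ?n * (1 / (1 - q)))"
      using q V by (intro suminf_ennreal_eq sums_mult geometric_sums) auto
    also have "\<dots> \<le> ennreal A" unfolding A_def by (intro ennreal_leI) simp
    finally show ?thesis .
  qed
  ultimately show ?thesis by (rule that)
qed

text \<open>Measurability of a parameter integral needs an integrand that is jointly measurable in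
  \<open>x\<close> and \<open>y\<close>. As \<open>f\<close> is only Lebesgue measurable, it is
  first replaced by a Borel function \<open>h\<close> that agrees with it almost everywhere, which
  changes the integral for no \<open>x\<close>.\<close>

lemma borel_measurable_convolution:
  assumes "g \<in> borel_measurable borel" "f \<in> borel_measurable lebesgue"
  shows "convolution g f \<in> borel_measurable lebesgue"
proof -
  have [measurable]: "g \<in> borel_measurable borel" by fact
  have "(\<lambda>x. Re (f x)) \<in> borel_measurable lebesgue" "(\<lambda>x. Im (f x)) \<in> borel_measurable lebesgue"
    using assms(2) by measurable
  \<comment> \<open>Borel representatives are taken for the real and imaginary parts separately and
    recombined into \<open>h\<close>.\<close>
  then obtain u v where [measurable]: "u \<in> borel_measurable lborel" "v \<in> borel_measurable lborel"
    and ae: "AE x in lborel. Re (f x) = u x" "AE x in lborel. Im (f x) = v x"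
    by (blast dest: completion_ex_borel_measurable_real)
  define h where "h = (\<lambda>x. complex_of_real (u x) + \<i> * complex_of_real (v x))"
  have [measurable]: "h \<in> borel_measurable borel"
    unfolding h_def by measurable
  have "AE x in lborel. f x = h x"
    using ae by eventually_elim (simp add: h_def complex_eq_iff)
  then have fh: "AE x in lebesgue. f x = h x" by (rule AE_completion)
  have "convolution g f x = (\<integral>y. g (x - y) *\<^sub>R h y \<partial>lborel)" for x
  proof -
    have "convolution g f x = (\<integral>y. g (x - y) *\<^sub>R h y \<partial>lebesgue)"
      unfolding convolution_def
    proof (rule integral_cong_AE)
      show "(\<lambda>y. g (x - y) *\<^sub>R h y) \<in> borel_measurable lebesgue"
        by (intro measurable_completion) measurable
      have "(\<lambda>y. g (x - y)) \<in> borel_measurable lebesgue"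
        by (intro measurable_completion) measurable
      then show "(\<lambda>y. g (x - y) *\<^sub>R f y) \<in> borel_measurable lebesgue"
        using assms(2) by measurable
    qed (use fh in auto)
    also have "\<dots> = (\<integral>y. g (x - y) *\<^sub>R h y \<partial>lborel)"
      by (intro integral_completion) measurable
    finally show ?thesis .
  qed
  then have "convolution g f = (\<lambda>x. \<integral>y. g (x - y) *\<^sub>R h y \<partial>lborel)" ..
  also have "\<dots> \<in> borel_measurable lborel" by measurable
  finally show ?thesis by (rule measurable_completion)
qed

section \<open>Modular estimates\<close>

lemma omega_mono:
  assumes "0 \<le> u" "u \<le> v"
  shows "omega q u \<le> omega q v"
  using assms by (auto simp: omega_def intro!: ennreal_leI powr_mono2)

text \<open>This is the convexity of \<open>omega q\<close> together with its vanishing at 0. For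
  finite \<open>q\<close> it reduces to \<open>l powr q \<le> l\<close>. It serves to shrink a
  finite modular below 1.\<close>

lemma omega_scale_le:
  assumes q: "1 \<le> q" and l: "0 < l" "l \<le> 1" and u: "0 \<le> u"
  shows "omega q (l * u) \<le> ennreal l * omega q u"
proof (cases "q = \<infinity>")
  case True
  have "l * u \<le> u" using l u by (simp add: mult_left_le_one_le)
  then show ?thesis using True l by (auto simp: omega_def ennreal_mult_top)
next
  case False
  then have r: "1 \<le> enn2real q" using q enn2real_mono[of 1 q] by (simp add: less_top)
  have "l powr enn2real q \<le> l powr 1" using l r by (intro powr_mono') auto
  then have "(l * u) powr enn2real q \<le> l * u powr enn2real q"
    using l u by (simp add: powr_mult mult_right_mono)
  then show ?thesis using False l by (simp add: omega_def ennreal_mult[symmetric] ennreal_leI)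
qed

text \<open>Splits \<open>u\<close> at height \<open>K\<close>. Above \<open>K\<close> and for a
  finite exponent \<open>r\<close>, \<open>u = u powr r * u powr (1 - r)\<close>, and the second
  factor is at most \<open>K powr (1 - r) = K * K powr (- r) \<le> K * N\<close>. For
  \<open>q = \<infinity>\<close> the right-hand side is infinite above \<open>K\<close>. The later
  choice is \<open>N = t powr n\<close>.\<close>

lemma le_add_omega:
  assumes q: "1 \<le> q" and K: "1 \<le> K" and N: "0 < N" and u: "0 \<le> u"
    and KN: "q \<noteq> \<infinity> \<Longrightarrow> K powr (- enn2real q) \<le> N"
  shows "ennreal u \<le> ennreal K + ennreal (K * N) * omega q u"
proof (cases "u \<le> K")
  case True
  then show ?thesis by (simp add: add_increasing2 ennreal_leI)
next
  case uK: False
  show ?thesis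
  proof (cases "q = \<infinity>")
    case True
    then show ?thesis using uK K N by (simp add: omega_def ennreal_mult_top)
  next
    case False
    define r where "r = enn2real q"
    have r: "1 \<le> r" using q False enn2real_mono[of 1 q] by (simp add: less_top r_def)
    have "u = u powr r * u powr (1 - r)" using uK K by (simp add: powr_add[symmetric])
    also have "\<dots> \<le> u powr r * K powr (1 - r)"
      using uK K r by (intro mult_left_mono powr_mono2') auto
    also have "K powr (1 - r) = K * K powr (- r)" using K powr_add[of K 1 "- r"] by simp
    also have "u powr r * (K * K powr (- r)) \<le> u powr r * (K * N)"
      using KN[OF False] K by (intro mult_left_mono) (auto simp: r_def)
    finally have "u \<le> K * N * u powr r" by (simp add: mult.commute)
    then have "ennreal u \<le> ennreal (K * N) * omega q u"
      using False K N by (simp add: omega_def r_def ennreal_mult[symmetric] ennreal_leI)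
    then show ?thesis by (simp add: add_increasing)
  qed
qed

text \<open>If \<open>b *\<^sub>R f\<close> has modular \<open>M\<close>, shrinking it by
  \<open>l = 1 / (1 + M)\<close> brings the modular to at most \<open>l * M \<le> 1\<close>. The
  bound on \<open>p\<close> is required only almost everywhere, as for \<open>p / 2\<close> it comes
  from the essential infimum.\<close>

lemma Lp_var_norm_set_nonempty:
  assumes p: "AE x in lebesgue. 1 \<le> p x" and pm: "p \<in> borel_measurable lebesgue"
    and f: "f \<in> Lp_var p"
  obtains a where "a > 0" "modular p (\<lambda>x. f x /\<^sub>R a) \<le> 1"
proof -
  obtain b where b: "b > 0" and fin: "modular p (\<lambda>x. b *\<^sub>R f x) < \<infinity>"
    using f by (auto simp: Lp_var_def)
  have fm: "f \<in> borel_measurable lebesgue" using f by (simp add: Lp_var_def)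
  define M where "M = enn2real (modular p (\<lambda>x. b *\<^sub>R f x))"
  have M: "modular p (\<lambda>x. b *\<^sub>R f x) = ennreal M" "0 \<le> M" using fin by (auto simp: M_def)
  define l where "l = 1 / (1 + M)"
  have l: "0 < l" "l \<le> 1" "l * M \<le> 1" using M(2) by (auto simp: l_def field_simps)
  have [measurable]: "(\<lambda>x. omega (p x) (norm (b *\<^sub>R f x))) \<in> borel_measurable lebesgue"
    using fm pm unfolding omega_def by measurable
  have "modular p (\<lambda>x. f x /\<^sub>R (1 / (l * b)))
      \<le> (\<integral>\<^sup>+ x. ennreal l * omega (p x) (norm (b *\<^sub>R f x)) \<partial>lebesgue)"
    unfolding modular_def
  proof (rule nn_integral_mono_AE, use p in eventually_elim)
    fix x assume "1 \<le> p x"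
    then show "omega (p x) (norm (f x /\<^sub>R (1 / (l * b)))) \<le> ennreal l * omega (p x) (norm (b *\<^sub>R f x))"
      using omega_scale_le[of "p x" l "norm (b *\<^sub>R f x)"] l b by (simp add: mult.assoc)
  qed
  also have "\<dots> = ennreal l * modular p (\<lambda>x. b *\<^sub>R f x)"
    unfolding modular_def by (rule nn_integral_cmult) measurable
  also have "\<dots> \<le> 1" using l M by (simp add: ennreal_mult[symmetric])
  finally show ?thesis using l b by (intro that[of "1 / (l * b)"]) auto
qed

text \<open>Constants have finite norm: for \<open>B = exp (c * k)\<close> the logarithmic lower
  bound on \<open>p\<close> turns \<open>(1 / B) powr p x\<close> into at most
  \<open>(exp 1 + norm x) powr (- k)\<close>, which is integrable for large \<open>k\<close>. Where
  \<open>p x = \<infinity>\<close> the integrand vanishes because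
  \<open>1 / B \<le> 1\<close>.\<close>

lemma modular_const_le_1:
  fixes p :: "real^'n \<Rightarrow> ennreal"
  assumes "p \<in> log_exponents" "exponent_infinity p = \<infinity>"
  obtains B where "B \<ge> 1" "(\<integral>\<^sup>+ x. omega (p x) (1 / B) \<partial>lebesgue) \<le> 1"
proof -
  obtain c where c: "c > 0" "\<And>x. p x \<noteq> \<infinity> \<Longrightarrow> ln (exp 1 + norm x) / c \<le> enn2real (p x)"
    using log_exponent_ge_ln[OF assms] by blast
  define m where "m = real CARD('n) + 1"
  obtain A where A: "A > 0" "\<And>t (x::real^'n). t > 0 \<Longrightarrow> (\<integral>\<^sup>+ y. ennreal (eta t m (x - y)) \<partial>lebesgue) \<le> ennreal A"
    using nn_integral_eta_bound[of m, where ?'n='n] unfolding m_def by auto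
  \<comment> \<open>The power \<open>m\<close> provides integrability; the surplus
    \<open>k - m \<ge> ln A\<close> yields a factor \<open>exp (m - k) \<le> 1 / A\<close> that
    absorbs the value of the integral.\<close>
  define k where "k = m + max 0 (ln A)"
  have k: "k \<ge> m" "m > 0" "ln A \<le> k - m" by (auto simp: k_def m_def)
  define B where "B = exp (c * k)"
  have B: "B \<ge> 1" using c k by (simp add: B_def)
  have om: "omega (p x) (1 / B) \<le> ennreal (exp (m - k)) * ennreal (eta 1 m (0 - x))" for x
  proof (cases "p x = \<infinity>")
    case True
    then show ?thesis using B by (simp add: omega_def)
  next
    case False
    have e1: "exp 1 + norm x \<ge> exp (1::real)" by simp
    have pos: "exp 1 + norm x > 0" by (smt (verit) norm_ge_zero exp_gt_zero)
    have "(1 / B) powr enn2real (p x) = exp (- (c * k) * enn2real (p x))"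
      by (simp add: B_def powr_def ln_div)
    also have "\<dots> \<le> exp (- k * ln (exp 1 + norm x))"
    proof -
      have "ln (exp 1 + norm x) \<le> c * enn2real (p x)" using c(1) c(2)[OF False] by (simp add: field_simps)
      then have "k * ln (exp 1 + norm x) \<le> k * (c * enn2real (p x))" using k by (intro mult_left_mono) auto
      then show ?thesis by (simp add: algebra_simps)
    qed
    also have "\<dots> = exp (- (k - m) * ln (exp 1 + norm x)) * exp (- m * ln (exp 1 + norm x))"
      by (simp add: exp_add[symmetric] algebra_simps)
    also have "\<dots> \<le> exp (m - k) * (1 + norm x) powr (- m)"
    proof (rule mult_mono)
      \<comment> \<open>Since the logarithm is at least 1, the surplus power contributes at most the
        constant \<open>exp (m - k)\<close>.\<close>
      have "1 \<le> ln (exp 1 + norm x)" using e1 pos by (simp add: ln_ge_iff)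
      then have "(k - m) * 1 \<le> (k - m) * ln (exp 1 + norm x)" using k by (intro mult_left_mono) auto
      then have "- (k - m) * ln (exp 1 + norm x) \<le> m - k" by (simp only: mult_minus_left mult_1_right)
      then show "exp (- (k - m) * ln (exp 1 + norm x)) \<le> exp (m - k)" by simp
      have "exp (- m * ln (exp 1 + norm x)) = (exp 1 + norm x) powr (- m)"
        using pos by (simp add: powr_def)
      also have "\<dots> \<le> (1 + norm x) powr (- m)"
        using k by (intro powr_mono2') (auto simp: add_pos_nonneg)
      finally show "exp (- m * ln (exp 1 + norm x)) \<le> (1 + norm x) powr (- m)" .
    qed auto
    finally show ?thesis using False by (simp add: omega_def eta_def ennreal_mult[symmetric] ennreal_leI)
  qed
  have "(\<lambda>x::real^'n. eta 1 m (0 - x)) \<in> borel_measurable lborel" by measurable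
  then have [measurable]: "(\<lambda>x::real^'n. eta 1 m (0 - x)) \<in> borel_measurable lebesgue"
    by (rule measurable_completion)
  have "(\<integral>\<^sup>+ x. omega (p x) (1 / B) \<partial>lebesgue) \<le> (\<integral>\<^sup>+ x. ennreal (exp (m - k)) * ennreal (eta 1 m (0 - x :: real^'n)) \<partial>lebesgue)"
    by (rule nn_integral_mono) (rule om)
  also have "\<dots> = ennreal (exp (m - k)) * (\<integral>\<^sup>+ x. ennreal (eta 1 m (0 - x :: real^'n)) \<partial>lebesgue)"
    by (intro nn_integral_cmult) measurable
  also have "\<dots> \<le> ennreal (exp (m - k)) * ennreal A"
    by (intro mult_left_mono A(2)) auto
  also have "\<dots> \<le> 1"
  proof -
    have "A \<le> exp (k - m)" using k(3) A(1) by (simp add: ln_le_cancel_iff[symmetric])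
    then have "exp (m - k) * A \<le> exp (m - k) * exp (k - m)" by (intro mult_left_mono) auto
    then show ?thesis using A by (simp add: ennreal_mult[symmetric] exp_add[symmetric])
  qed
  finally show ?thesis using B that by blast
qed

section \<open>The uniform bound on the convolution\<close>

text \<open>This is where the exponent \<open>vartheta\<close> comes from. For
  \<open>t \<le> 1\<close> the left-hand side is \<open>t powr (n * q / exponent_minus p)\<close>,
  and the quotient \<open>q / exponent_minus p\<close> is at least 1. For \<open>t > 1\<close> the
  left-hand side is 1.\<close>

lemma powr_vartheta:
  fixes p :: "real^'n \<Rightarrow> ennreal"
  assumes t: "t > 0" and q: "exponent_minus p \<le> q" "q \<noteq> \<infinity>" "2 \<le> exponent_minus p"
  shows "(t powr (- (real CARD('n) * vartheta p t))) powr (- enn2real (q / 2)) \<le> t powr real CARD('n)"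
proof (cases "t \<le> 1")
  case True
  let ?e = "enn2real (exponent_minus p)"
  \<comment> \<open>Finiteness passes from \<open>q\<close> to the essential infimum, so that
    \<open>enn2real\<close> does not collapse it to 0.\<close>
  have fin: "exponent_minus p \<noteq> \<infinity>" using q by (auto simp: top_unique)
  have e: "2 \<le> ?e" "?e \<le> enn2real q"
    using q fin enn2real_mono[of 2 "exponent_minus p"] enn2real_mono[of "exponent_minus p" q]
    by (auto simp: less_top)
  have "real CARD('n) * 1 \<le> real CARD('n) * (vartheta p t * (enn2real q / 2))"
    using True e by (intro mult_left_mono) (auto simp: vartheta_def enn2real_divide field_simps)
  then show ?thesis using True t
    by (simp add: powr_powr enn2real_divide powr_mono' mult.assoc)
next
  case False
  then show ?thesis by (simp add: vartheta_def ge_one_powr_ge_zero)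
qed

text \<open>In the splitting of \<open>norm (h y)\<close> at height \<open>K\<close>, the constant
  part costs \<open>K\<close> times the integral of the kernel, at most \<open>K * A\<close>. In the
  other part the supremum \<open>t powr (- n)\<close> of the kernel cancels the factor
  \<open>t powr n\<close>, leaving \<open>K\<close> times the modular, at most
  \<open>K\<close>.\<close>

lemma nn_integral_eta_mult_le:
  fixes p :: "real^'n \<Rightarrow> ennreal" and h :: "real^'n \<Rightarrow> complex"
  assumes t: "t > 0" and m: "m > 0" and p2: "2 \<le> exponent_minus p"
    and pm: "p \<in> borel_measurable lebesgue" and hm: "h \<in> borel_measurable lebesgue"
    and mod: "modular (\<lambda>x. p x / 2) h \<le> 1"
    and A: "A \<ge> 0" "(\<integral>\<^sup>+ y. ennreal (eta t m (x - y)) \<partial>lebesgue) \<le> ennreal A"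
  shows "(\<integral>\<^sup>+ y. ennreal (norm (eta t m (x - y) *\<^sub>R h y)) \<partial>lebesgue)
    \<le> ennreal ((A + 1) * t powr (- (real CARD('n) * vartheta p t)))"
proof -
  let ?n = "real CARD('n)"
  define K where "K = t powr (- (?n * vartheta p t))"
  have K: "1 \<le> K"
  proof (cases "t \<le> 1")
    case True
    have "0 \<le> vartheta p t" by (simp add: vartheta_def)
    then show ?thesis using t True powr_mono'[of "- (?n * vartheta p t)" 0 t] by (simp add: K_def)
  qed (simp add: K_def vartheta_def)
  let ?o = "\<lambda>y. omega (p y / 2) (norm (h y))"
  have "(\<lambda>y. eta t m (x - y)) \<in> borel_measurable lborel" by measurable
  then have [measurable]: "(\<lambda>y. eta t m (x - y)) \<in> borel_measurable lebesgue"
    by (rule measurable_completion)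
  have [measurable]: "?o \<in> borel_measurable lebesgue"
    using pm hm unfolding omega_def by measurable
  have "(\<integral>\<^sup>+ y. ennreal (norm (eta t m (x - y) *\<^sub>R h y)) \<partial>lebesgue)
      \<le> (\<integral>\<^sup>+ y. ennreal K * ennreal (eta t m (x - y)) + ennreal K * ?o y \<partial>lebesgue)"
  proof (rule nn_integral_mono_AE, use AE_exponent_minus_le[of p] in eventually_elim)
    fix y assume py: "exponent_minus p \<le> p y"
    have "2 / 2 \<le> p y / 2" using p2 py by (intro divide_right_mono_ennreal) simp
    then have "1 \<le> p y / 2" by simp
    moreover have "K powr (- enn2real (p y / 2)) \<le> t powr ?n" if "p y / 2 \<noteq> \<infinity>"
      unfolding K_def using that t py p2
      by (intro powr_vartheta) (auto simp: ennreal_top_divide)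
    ultimately have "ennreal (norm (h y)) \<le> ennreal K + ennreal (K * t powr ?n) * ?o y"
      using K t by (intro le_add_omega) auto
    then have "ennreal (eta t m (x - y)) * ennreal (norm (h y))
        \<le> ennreal (eta t m (x - y)) * (ennreal K + ennreal (K * t powr ?n) * ?o y)"
      by (intro mult_left_mono) auto
    also have "\<dots> = ennreal K * ennreal (eta t m (x - y))
        + ennreal (eta t m (x - y) * (K * t powr ?n)) * ?o y"
      using K by (simp add: distrib_left ennreal_mult eta_nonneg mult_ac)
    also have "\<dots> \<le> ennreal K * ennreal (eta t m (x - y)) + ennreal K * ?o y"
    proof (intro add_left_mono mult_right_mono ennreal_leI)
      have "eta t m (x - y) * (K * t powr ?n) \<le> t powr (- ?n) * (K * t powr ?n)"
        using K t m by (intro mult_right_mono eta_le) auto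
      also have "\<dots> = K * (t powr (- ?n) * t powr ?n)" by simp
      also have "\<dots> = K" using t by (simp only: powr_add[symmetric]) simp
      finally show "eta t m (x - y) * (K * t powr ?n) \<le> K" .
    qed auto
    finally show "ennreal (norm (eta t m (x - y) *\<^sub>R h y))
        \<le> ennreal K * ennreal (eta t m (x - y)) + ennreal K * ?o y"
      by (simp add: eta_nonneg ennreal_mult)
  qed
  also have "\<dots> = ennreal K * (\<integral>\<^sup>+ y. ennreal (eta t m (x - y)) \<partial>lebesgue)
      + ennreal K * modular (\<lambda>x. p x / 2) h"
    unfolding modular_def by (simp add: nn_integral_add nn_integral_cmult)
  also have "\<dots> \<le> ennreal K * ennreal A + ennreal K * 1"
    by (intro add_mono mult_left_mono A mod) auto
  also have "\<dots> = ennreal ((A + 1) * K)"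
    using K A(1) by (simp add: ennreal_mult[symmetric] ennreal_plus[symmetric] algebra_simps
        del: ennreal_plus)
  finally show ?thesis unfolding K_def .
qed

text \<open>Homogeneity reduces the claim to the normalized function \<open>f /\<^sub>R a\<close>.
  One bound on the integral of the norm yields both integrability and the pointwise
  estimate.\<close>

lemma convolution_eta_bound:
  fixes p :: "real^'n \<Rightarrow> ennreal" and f :: "real^'n \<Rightarrow> complex"
  assumes t: "t > 0" and m: "m > 0" and p2: "2 \<le> exponent_minus p"
    and pm: "p \<in> borel_measurable lebesgue" and fm: "f \<in> borel_measurable lebesgue"
    and a: "a > 0" and mod: "modular (\<lambda>x. p x / 2) (\<lambda>x. f x /\<^sub>R a) \<le> 1"
    and A: "A \<ge> 0" "(\<integral>\<^sup>+ y. ennreal (eta t m (x - y)) \<partial>lebesgue) \<le> ennreal A"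
  shows "integrable lebesgue (\<lambda>y. eta t m (x - y) *\<^sub>R f y)"
    and "norm (convolution (eta t m) f x)
      \<le> (A + 1) * t powr (- (real CARD('n) * vartheta p t)) * a"
proof -
  let ?K = "t powr (- (real CARD('n) * vartheta p t))"
  have "(\<lambda>y. eta t m (x - y)) \<in> borel_measurable lborel" by measurable
  then have [measurable]: "(\<lambda>y. eta t m (x - y)) \<in> borel_measurable lebesgue"
    by (rule measurable_completion)
  note [measurable] = fm
  have "(\<integral>\<^sup>+ y. ennreal (norm (eta t m (x - y) *\<^sub>R f y)) \<partial>lebesgue)
      = (\<integral>\<^sup>+ y. ennreal a * ennreal (norm (eta t m (x - y) *\<^sub>R (f y /\<^sub>R a))) \<partial>lebesgue)"
    using a by (intro nn_integral_cong) (simp add: ennreal_mult[symmetric] abs_mult field_simps)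
  also have "\<dots> = ennreal a * (\<integral>\<^sup>+ y. ennreal (norm (eta t m (x - y) *\<^sub>R (f y /\<^sub>R a))) \<partial>lebesgue)"
    by (intro nn_integral_cmult) measurable
  also have "\<dots> \<le> ennreal a * ennreal ((A + 1) * ?K)"
    using t m p2 pm mod A by (intro mult_left_mono nn_integral_eta_mult_le) auto
  also have "\<dots> = ennreal ((A + 1) * ?K * a)"
    using a A(1) by (simp add: ennreal_mult[symmetric] mult.commute)
  finally have le: "(\<integral>\<^sup>+ y. ennreal (norm (eta t m (x - y) *\<^sub>R f y)) \<partial>lebesgue) \<le> ennreal ((A + 1) * ?K * a)" .
  show int: "integrable lebesgue (\<lambda>y. eta t m (x - y) *\<^sub>R f y)"
  proof (rule integrableI_bounded)
    show "(\<integral>\<^sup>+ y. ennreal (norm (eta t m (x - y) *\<^sub>R f y)) \<partial>lebesgue) < \<infinity>"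
      using le by (rule order.strict_trans1) simp
  qed measurable
  have "ennreal (norm (convolution (eta t m) f x)) \<le> ennreal ((A + 1) * ?K * a)"
    unfolding convolution_def using integral_norm_bound_ennreal[OF int] le by (rule order_trans)
  then show "norm (convolution (eta t m) f x) \<le> (A + 1) * ?K * a"
    using A(1) a by (subst (asm) ennreal_le_iff) auto
qed

section \<open>From the uniform bound to the norm inequality\<close>

theorem lemma3p4:
  fixes p :: "real^'n \<Rightarrow> ennreal" and m :: real
  assumes "p \<in> log_exponents"
    and "m > real CARD('n)"
    and "2 \<le> exponent_minus p"
    and "exponent_infinity p = \<infinity>"
  shows "\<exists>C::real. C > 0 \<and>
    (\<forall>t::real. t > 0 \<longrightarrow>
      (\<forall>f \<in> Lp_var (\<lambda>x. p x / 2).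
        convolution_exists (eta t m) f \<and>
        convolution (eta t m) f \<in> Lp_var p \<and>
        Lp_var_norm p (convolution (eta t m) f)
          \<le> ennreal (C * t powr (- (real CARD('n) * vartheta p t))) * Lp_var_norm (\<lambda>x. p x / 2) f))"
proof -
  have pm [measurable]: "p \<in> borel_measurable lebesgue"
    using assms(1) by (simp add: log_exponents_def exponents_def)
  have m: "m > 0" using assms(2) by (rule order.strict_trans1[rotated]) simp
  obtain A where A: "A > 0" "\<And>t (x::real^'n). t > 0 \<Longrightarrow> (\<integral>\<^sup>+ y. ennreal (eta t m (x - y)) \<partial>lebesgue) \<le> ennreal A"
    using nn_integral_eta_bound[OF assms(2)] by blast
  obtain B where B: "B \<ge> 1" "(\<integral>\<^sup>+ x. omega (p x) (1 / B) \<partial>lebesgue) \<le> 1"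
    using modular_const_le_1[OF assms(1,4)] by blast
  \<comment> \<open>The factor \<open>A + 1\<close> comes from the uniform bound on the convolution,
    and \<open>B\<close> normalizes constants in the modular of \<open>p\<close>.\<close>
  define C where "C = B * (A + 1)"
  have C: "C > 0" using A B by (simp add: C_def)
  have "convolution_exists (eta t m) f \<and> convolution (eta t m) f \<in> Lp_var p \<and>
      Lp_var_norm p (convolution (eta t m) f)
        \<le> ennreal (C * t powr (- (real CARD('n) * vartheta p t))) * Lp_var_norm (\<lambda>x. p x / 2) f"
    if t: "t > 0" and f: "f \<in> Lp_var (\<lambda>x. p x / 2)" for t f
  proof (intro conjI)
    let ?K = "t powr (- (real CARD('n) * vartheta p t))"
    let ?F = "convolution (eta t m) f"
    let ?S = "{a. a > 0 \<and> modular (\<lambda>x. p x / 2) (\<lambda>x. f x /\<^sub>R a) \<le> 1}"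
    have fm: "f \<in> borel_measurable lebesgue" using f by (simp add: Lp_var_def)
    have CK: "C * ?K > 0" using C t by simp
    note bound = convolution_eta_bound[OF t m assms(3) pm fm _ _ less_imp_le[OF A(1)] A(2)[OF t]]
    \<comment> \<open>Each \<open>a\<close> admissible for the norm of \<open>f\<close> makes
      \<open>C * ?K * a\<close> admissible for the norm of \<open>?F\<close>, because the rescaled
      convolution is bounded by \<open>1 / B\<close> everywhere.\<close>
    have F_mod: "modular p (\<lambda>x. ?F x /\<^sub>R (C * ?K * a)) \<le> 1" if "a \<in> ?S" for a
    proof -
      have "modular p (\<lambda>x. ?F x /\<^sub>R (C * ?K * a)) \<le> (\<integral>\<^sup>+ x. omega (p x) (1 / B) \<partial>lebesgue)"
        unfolding modular_def
      proof (intro nn_integral_mono omega_mono)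
        fix x
        have "norm (?F x) \<le> (A + 1) * ?K * a" using that by (intro bound(2)) auto
        moreover have pos: "0 < (A + 1) * ?K * a" using that A t by simp
        ultimately have "norm (?F x) / ((A + 1) * ?K * a) \<le> 1" by (simp only: pos_divide_le_eq mult_1_left)
        then have "norm (?F x) / ((A + 1) * ?K * a) / B \<le> 1 / B" using B by (intro divide_right_mono) auto
        moreover have "norm (?F x /\<^sub>R (C * ?K * a)) = norm (?F x) / (C * ?K * a)"
        proof -
          have "C * ?K * a > 0" using that CK by simp
          then show ?thesis by (simp only: norm_scaleR abs_inverse abs_of_pos divide_inverse mult.commute)
        qed
        moreover have "C * ?K * a = (A + 1) * ?K * a * B" by (simp only: C_def mult_ac)
        ultimately show "norm (?F x /\<^sub>R (C * ?K * a)) \<le> 1 / B" by (simp only: divide_divide_eq_left)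
      qed auto
      then show ?thesis using B(2) by (rule order_trans)
    qed
    have "AE x in lebesgue. 1 \<le> p x / 2"
      using AE_exponent_minus_le[of p]
    proof eventually_elim
      fix x assume "exponent_minus p \<le> p x"
      then have "2 / 2 \<le> p x / 2" using assms(3) by (intro divide_right_mono_ennreal) simp
      then show "1 \<le> p x / 2" by simp
    qed
    then obtain a0 where a0: "a0 \<in> ?S"
      using f by (elim Lp_var_norm_set_nonempty) auto
    show "convolution_exists (eta t m) f"
      unfolding convolution_exists_def using a0 by (intro AE_I2 bound(1)) auto
    have "?F \<in> borel_measurable lebesgue"
      using fm by (intro borel_measurable_convolution) measurable
    moreover have "inverse (C * ?K * a0) > 0"
      using a0 C t by simp
    moreover have "modular p (\<lambda>x. inverse (C * ?K * a0) *\<^sub>R ?F x) < \<infinity>"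
      using F_mod[OF a0] by (rule order.strict_trans1) simp
    ultimately show "?F \<in> Lp_var p" unfolding Lp_var_def by blast
    have "Lp_var_norm p ?F \<le> ennreal (C * ?K) * ennreal a" if "a \<in> ?S" for a
      unfolding Lp_var_norm_def using that CK F_mod[OF that]
      by (intro Inf_lower) (auto simp: ennreal_mult[symmetric] intro!: exI[of _ "C * ?K * a"])
    \<comment> \<open>Dividing by the constant isolates a lower bound for all admissible
      \<open>a\<close>, hence for their infimum. Multiplying back is legitimate because
      \<open>C * ?K\<close> is positive and finite.\<close>
    then have "Lp_var_norm p ?F / ennreal (C * ?K) \<le> ennreal a" if "a \<in> ?S" for a
      using that CK by (intro divide_le_posI_ennreal) (auto simp: mult.commute)
    then have "Lp_var_norm p ?F / ennreal (C * ?K) \<le> Lp_var_norm (\<lambda>x. p x / 2) f"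
      unfolding Lp_var_norm_def[of "\<lambda>x. p x / 2"] by (intro Inf_greatest) auto
    then have "ennreal (C * ?K) * (Lp_var_norm p ?F / ennreal (C * ?K))
        \<le> ennreal (C * ?K) * Lp_var_norm (\<lambda>x. p x / 2) f"
      by (rule mult_left_mono) simp
    also have "ennreal (C * ?K) * (Lp_var_norm p ?F / ennreal (C * ?K)) = Lp_var_norm p ?F"
      unfolding ennreal_times_divide mult.commute[of "ennreal (C * ?K)"]
      using CK by (intro ennreal_mult_divide_eq) auto
    finally show "Lp_var_norm p ?F \<le> ennreal (C * ?K) * Lp_var_norm (\<lambda>x. p x / 2) f" .
  qed
  with C show ?thesis by blast
qed

end
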